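(* Let $n=3$ and consider the gradient method $x_{k+1}=x_k-\alpha_k g_k$, with the invariance property under orthogonal transformations, applied to $\min_{x\in\mathbb{R}^3} f(x)=\frac12 x^{\sf T}Ax-b^{\sf T}x$, where $A\in\mathbb{R}^{3\times 3}$ is symmetric positive definite with eigenvalues $\lambda_1\le\lambda_2\le\lambda_3$ and $b\in\mathbb{R}^3$. If $u_k,v_k,r_k\in\mathbb{R}^3$ are orthonormal vectors and $\alpha_k=\alpha_k^{new}$, then $g_{k+i}^{(3)}=0$ for all $i\ge 1$. Further, if $\alpha_{k+j_0}$ has the two-dimensional quadratic termination property for some $j_0\ge 3$, and $\alpha_{k+j}$ has the form $$\alpha_{k+j}=\left(\frac{g_{k+i_0}^{\sf T}\psi(A)g_{k+i_0}}{g_{k+i_0}^{\sf T}\psi(A)A^{c}g_{k+i_0}}\right)^{1/c}$$ for some $j\ge j_0+1$ with $i_0\in\{j_0+1,\ldots,j\}$, where $c$ is some nonzero real number and $\psi$ is an admissible function, then $g_{k+i}=0$ for some $1\le i\le j+1$.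
   Context: Here $g_k=\nabla f(x_k)=Ax_k-b$, $\alpha_k>0$ is the stepsize, and iterations are indexed from $1$. "Invariance under orthogonal transformations" means that applying the method after an orthogonal change of variables produces the correspondingly transformed iterates with the same stepsizes; accordingly one works in coordinates in which $A=\mathrm{diag}\{\lambda_1,\lambda_2,\lambda_3\}$, and $g_k^{(i)}$ denotes the $i$-th component of $g_k$ in these coordinates (the component along the unit eigenvector of $\lambda_i$). Admissible function: a real analytic function $\psi$ on $[\lambda_1,\lambda_n]$ ($\lambda_1,\lambda_n$ the smallest and largest eigenvalues of $A$) that can be expressed by a Laurent series $\psi(z)=\sum_{l=-\infty}^{\infty}c_lz^l$, $c_l\in\mathbb{R}$, with $0<\sum_{l=-\infty}^{\infty}c_lz^l<+\infty$ for all $z\in[\lambda_1,\lambda_n]$. The stepsize $\alpha_k^{new}$: given vectors $u_k,v_k,r_k$, let $$H_k=\begin{pmatrix}u_k^{\sf T}Au_k&u_k^{\sf T}Av_k&u_k^{\sf T}Ar_k\\ v_k^{\sf T}Au_k&v_k^{\sf T}Av_k&v_k^{\sf T}Ar_k\\ r_k^{\sf T}Au_k&r_k^{\sf T}Av_k&r_k^{\sf T}Ar_k\end{pmatrix};$$ then $\alpha_k^{new}$ is the reciprocal of the largest root of $$z^3-\mathrm{tr}(H_k)z^2+\frac{\mathrm{tr}^2(H_k)-\mathrm{tr}(H_k^2)}{2}z-\det(H_k)=0.$$ Two-dimensional quadratic termination property: a stepsize $\alpha_k$ has this property if it satisfies $$g_{\nu_1(k)}^{\sf T}\psi_1(A)(I-\alpha_kA)g_k\cdot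 g_{\nu_2(k)}^{\sf T}\psi_2(A)(I-\alpha_kA)g_k=g_{\nu_1(k)}^{\sf T}\psi_3(A)(I-\alpha_kA)g_k\cdot g_{\nu_2(k)}^{\sf T}\psi_4(A)(I-\alpha_kA)g_k$$ for some $\nu_1(k),\nu_2(k)\in\{1,\ldots,k\}$, where $\psi_1,\psi_2,\psi_3,\psi_4$ are admissible functions satisfying $\psi_1(z)\psi_2(z)=\psi_3(z)\psi_4(z)$ for $z\in\mathbb{R}$.
   Formalization: The two-dimensional quadratic termination property additionally requires that its equation not hold for all positive stepsizes, unless the gradient is zero or an eigenvector; otherwise every stepsize would have the property (all ψ's equal 1) and the second conclusion would fail. *)

theory Defs
  imports "HOL-Analysis.Analysis"
begin

section \<open>Symmetric matrices, spectrum and functions of a matrix\<close>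

definition sym_pos_def :: "real^'n^'n \<Rightarrow> bool" where
  "sym_pos_def A \<longleftrightarrow> transpose A = A \<and> (\<forall>w. w \<noteq> 0 \<longrightarrow> w \<bullet> (A *v w) > 0)"

definition spectrum :: "real^'n^'n \<Rightarrow> real set" where
  "spectrum A = {z. \<exists>w. w \<noteq> 0 \<and> A *v w = z *\<^sub>R w}"

definition orthonormal_family :: "('i \<Rightarrow> real^'n) \<Rightarrow> bool" where
  "orthonormal_family q \<longleftrightarrow> (\<forall>i j. q i \<bullet> q j = (if i = j then 1 else 0))"

text \<open>For symmetric \<open>A\<close>, \<open>mat_fun f A\<close> is the usual matrix function \<open>f(A)\<close>, i.e.
  \<open>diag (f \<lambda>\<^sub>1, \<dots>, f \<lambda>\<^sub>n)\<close> in an orthonormal basis in which \<open>A\<close> is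
  \<open>diag (\<lambda>\<^sub>1, \<dots>, \<lambda>\<^sub>n)\<close>; see \<open>mat_fun_eigenbasis\<close> below. For \<open>f\<close> given by a Laurent series
  it is the corresponding Laurent series in \<open>A\<close>; for \<open>f = (\<lambda>z. z powr c)\<close> and positive
  definite \<open>A\<close> it is the real power \<open>A\<^sup>c\<close>.\<close>

definition mat_fun :: "(real \<Rightarrow> real) \<Rightarrow> real^'n^'n \<Rightarrow> real^'n^'n" where
  "mat_fun f A = (THE B. \<forall>z w. A *v w = z *\<^sub>R w \<longrightarrow> B *v w = f z *\<^sub>R w)"

lemma orthonormal_family_expand:
  fixes q :: "'n::finite \<Rightarrow> real^'n"
  assumes "orthonormal_family q"
  shows "(\<Sum>i\<in>UNIV. (q i \<bullet> w) *\<^sub>R q i) = w"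
proof -
  define Q :: "real^'n^'n" where "Q = (\<chi> i. q i)"
  have "orthogonal_matrix Q"
    using assms by (auto simp: orthogonal_matrix_orthonormal_rows row_def Q_def
        orthonormal_family_def orthogonal_def norm_eq_1)
  then have "transpose Q ** Q = mat 1"
    by (simp add: orthogonal_matrix_def)
  then have "w = transpose Q *v (Q *v w)"
    by (simp add: matrix_vector_mul_assoc)
  also have "\<dots> = (\<Sum>i\<in>UNIV. (q i \<bullet> w) *\<^sub>R q i)"
    by (simp add: vec_eq_iff matrix_vector_mult_def transpose_def Q_def inner_vec_def mult.commute)
  finally show ?thesis by (rule sym)
qed

lemma mat_fun_eigenvector:
  fixes q :: "'n::finite \<Rightarrow> real^'n"
  assumes q: "orthonormal_family q" and eig: "\<And>i. A *v q i = l i *\<^sub>R q i"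
    and w: "A *v w = z *\<^sub>R w"
  shows "mat_fun f A *v w = f z *\<^sub>R w"
proof -
  let ?P = "\<lambda>B. \<forall>z w. A *v w = z *\<^sub>R w \<longrightarrow> B *v w = f z *\<^sub>R w"
  define T where "T = (\<lambda>w. \<Sum>i\<in>UNIV. (f (l i) * (q i \<bullet> w)) *\<^sub>R q i)"
  have "linear T"
    unfolding T_def
    by (rule linearI)
      (simp_all add: inner_add_right algebra_simps sum.distrib scaleR_sum_right)
  then have T: "matrix T *v w = T w" for w
    by (simp add: matrix_works linear_matrix_vector_mul_eq)
  have ex: "?P (matrix T)"
  proof (intro allI impI)
    fix z w assume a: "A *v w = z *\<^sub>R w"
    have qA: "q j \<bullet> (A *v w) = l j * (q j \<bullet> w)" for j
    proof -
      have "A *v w = A *v (\<Sum>i\<in>UNIV. (q i \<bullet> w) *\<^sub>R q i)"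
        using orthonormal_family_expand[OF q, of w] by simp
      also have "\<dots> = (\<Sum>i\<in>UNIV. (q i \<bullet> w) *\<^sub>R (l i *\<^sub>R q i))"
        by (simp add: linear_sum[OF matrix_vector_mul_linear] matrix_vector_mult_scaleR eig)
      finally have "q j \<bullet> (A *v w) = (\<Sum>i\<in>UNIV. (q i \<bullet> w) * (l i * (q j \<bullet> q i)))"
        by (simp add: inner_sum_right mult.assoc)
      also have "\<dots> = (\<Sum>i\<in>UNIV. if j = i then (q i \<bullet> w) * l i else 0)"
        using q by (intro sum.cong) (auto simp: orthonormal_family_def)
      finally show ?thesis by simp
    qed
    have "f (l i) * (q i \<bullet> w) = f z * (q i \<bullet> w)" for i
      using qA[of i] a by auto
    then have "T w = f z *\<^sub>R (\<Sum>i\<in>UNIV. (q i \<bullet> w) *\<^sub>R q i)"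
      by (simp only: T_def scaleR_sum_right scaleR_scaleR)
    then show "matrix T *v w = f z *\<^sub>R w"
      using orthonormal_family_expand[OF q, of w] T by simp
  qed
  have uniq: "B = matrix T" if B: "?P B" for B
  proof -
    have "B *v w = matrix T *v w" for w
    proof -
      have "B *v q i = matrix T *v q i" for i
        using B ex eig by metis
      then have "B *v (\<Sum>i\<in>UNIV. (q i \<bullet> w) *\<^sub>R q i) = matrix T *v (\<Sum>i\<in>UNIV. (q i \<bullet> w) *\<^sub>R q i)"
        by (simp add: linear_sum[OF matrix_vector_mul_linear] matrix_vector_mult_scaleR)
      then show ?thesis
        using orthonormal_family_expand[OF q, of w] by simp
    qed
    then show ?thesis by (simp add: matrix_eq)
  qed
  have "?P (mat_fun f A)"
    unfolding mat_fun_def by (rule theI[where P = "?P", OF ex uniq])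
  then show ?thesis using w by blast
qed

lemma mat_fun_eigenbasis:
  fixes q :: "'n::finite \<Rightarrow> real^'n"
  assumes "orthonormal_family q" and "\<And>i. A *v q i = l i *\<^sub>R q i"
  shows "mat_fun f A *v q i = f (l i) *\<^sub>R q i"
  using mat_fun_eigenvector[OF assms assms(2)] .


section \<open>Admissible functions\<close>

text \<open>Real analyticity of a function considered only on \<open>S\<close>: the local power series has to
  represent \<open>f\<close> at the points of \<open>S\<close>.\<close>

definition real_analytic_on :: "(real \<Rightarrow> real) \<Rightarrow> real set \<Rightarrow> bool" where
  "real_analytic_on f S \<longleftrightarrow>
     (\<forall>x\<in>S. \<exists>e>0. \<exists>a. \<forall>y\<in>S. \<bar>y - x\<bar> < e \<longrightarrow> (\<lambda>n. a n * (y - x) ^ n) sums f y)"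

text \<open>A two-sided series converges if its parts with nonnegative and with negative exponents
  both do.\<close>

definition laurent_sums :: "(int \<Rightarrow> real) \<Rightarrow> real \<Rightarrow> real \<Rightarrow> bool" where
  "laurent_sums c z s \<longleftrightarrow>
     (\<exists>s1 s2. (\<lambda>n. c (int n) * z powi int n) sums s1 \<and>
              (\<lambda>n. c (- int (Suc n)) * z powi (- int (Suc n))) sums s2 \<and> s = s1 + s2)"

definition admissible :: "real^'n^'n \<Rightarrow> (real \<Rightarrow> real) \<Rightarrow> bool" where
  "admissible A \<psi> \<longleftrightarrow>
     (let I = {Min (spectrum A) .. Max (spectrum A)} in
        real_analytic_on \<psi> I \<and>
        (\<exists>c. \<forall>z\<in>I. laurent_sums c z (\<psi> z) \<and> 0 < \<psi> z))"


section \<open>The gradient method\<close>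

definition quad_obj :: "real^'n^'n \<Rightarrow> real^'n \<Rightarrow> real^'n \<Rightarrow> real" where
  "quad_obj A b x = (x \<bullet> (A *v x)) / 2 - b \<bullet> x"

definition grad :: "real^'n^'n \<Rightarrow> real^'n \<Rightarrow> real^'n \<Rightarrow> real^'n" where
  "grad A b x = A *v x - b"

lemma quad_obj_has_gradient:
  assumes "transpose A = A"
  shows "(quad_obj A b has_derivative (\<lambda>h. grad A b x \<bullet> h)) (at x)"
proof -
  have s: "x \<bullet> (A *v h) = (A *v x) \<bullet> h" for h
    using dot_lmul_matrix[of x A h] assms by (metis transpose_matrix_vector)
  have d: "((*v) A has_derivative (*v) A) (at x)"
    by (intro bounded_linear_imp_has_derivative matrix_vector_mul_bounded_linear)
  have "((\<lambda>x. (x \<bullet> (A *v x)) / 2 - b \<bullet> x) has_derivative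
      (\<lambda>h. (x \<bullet> (A *v h) + h \<bullet> (A *v x)) / 2 - b \<bullet> h)) (at x)"
    by (intro has_derivative_diff bounded_linear.has_derivative[OF bounded_linear_divide] has_derivative_inner d
        has_derivative_ident has_derivative_inner_right)
  moreover have "(\<lambda>h. (x \<bullet> (A *v h) + h \<bullet> (A *v x)) / 2 - b \<bullet> h) = (\<lambda>h. grad A b x \<bullet> h)"
    by (simp add: fun_eq_iff grad_def inner_diff_left inner_diff_right s inner_commute)
  ultimately show ?thesis
    by (simp add: quad_obj_def[abs_def])
qed

text \<open>A gradient method is given by its stepsize rule: \<open>step A b x\<^sub>1 k\<close> is the stepsize used in
  iteration \<open>k\<close> when minimizing \<open>quad_obj A b\<close> from the starting point \<open>x\<^sub>1\<close>. Iterations are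
  indexed from 1; \<open>x 0\<close> is meaningless.\<close>

type_synonym 'n step_rule = "real^'n^'n \<Rightarrow> real^'n \<Rightarrow> real^'n \<Rightarrow> nat \<Rightarrow> real"

definition gradient_run ::
  "'n step_rule \<Rightarrow> real^'n^'n \<Rightarrow> real^'n \<Rightarrow> (nat \<Rightarrow> real^'n) \<Rightarrow> bool" where
  "gradient_run step A b x \<longleftrightarrow>
     (\<forall>k\<ge>1. x (Suc k) = x k - step A b (x 1) k *\<^sub>R grad A b (x k))"

text \<open>Substituting \<open>y = P x\<close> with \<open>P\<close> orthogonal turns \<open>quad_obj A b\<close> into
  \<open>quad_obj (P A P\<^sup>T) (P b)\<close>.\<close>

definition orthogonally_invariant :: "('n::finite) step_rule \<Rightarrow> bool" where
  "orthogonally_invariant step \<longleftrightarrow>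
     (\<forall>A b P x y.
        sym_pos_def A \<and> orthogonal_matrix P \<and>
        gradient_run step A b x \<and>
        gradient_run step (P ** A ** transpose P) (P *v b) y \<and> y 1 = P *v x 1
        \<longrightarrow> (\<forall>k\<ge>1. y k = P *v x k \<and>
               step (P ** A ** transpose P) (P *v b) (y 1) k = step A b (x 1) k))"


section \<open>Stepsizes\<close>

definition H_mat :: "real^3^3 \<Rightarrow> real^3 \<Rightarrow> real^3 \<Rightarrow> real^3 \<Rightarrow> real^3^3" where
  "H_mat A u v r =
     vector [vector [u \<bullet> (A *v u), u \<bullet> (A *v v), u \<bullet> (A *v r)],
             vector [v \<bullet> (A *v u), v \<bullet> (A *v v), v \<bullet> (A *v r)],
             vector [r \<bullet> (A *v u), r \<bullet> (A *v v), r \<bullet> (A *v r)]]"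

definition alpha_new :: "real^3^3 \<Rightarrow> real^3 \<Rightarrow> real^3 \<Rightarrow> real^3 \<Rightarrow> real" where
  "alpha_new A u v r =
     (let H = H_mat A u v r in
        1 / Max {z. z ^ 3 - trace H * z\<^sup>2 + ((trace H)\<^sup>2 - trace (H ** H)) / 2 * z - det H = 0})"

text \<open>The equation behind two-dimensional quadratic termination, for a gradient sequence \<open>g\<close>
  and a candidate stepsize \<open>t\<close> in iteration \<open>k\<close>.\<close>

definition termination_eq ::
  "real^'n^'n \<Rightarrow> (nat \<Rightarrow> real^'n) \<Rightarrow> nat \<Rightarrow> nat \<Rightarrow> nat \<Rightarrow> (real \<Rightarrow> real) \<Rightarrow> (real \<Rightarrow> real) \<Rightarrow>
   (real \<Rightarrow> real) \<Rightarrow> (real \<Rightarrow> real) \<Rightarrow> real \<Rightarrow> bool" where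
  "termination_eq A g k \<nu>1 \<nu>2 \<psi>1 \<psi>2 \<psi>3 \<psi>4 t \<longleftrightarrow>
     (g \<nu>1 \<bullet> (mat_fun \<psi>1 A *v ((mat 1 - t *\<^sub>R A) *v g k))) *
     (g \<nu>2 \<bullet> (mat_fun \<psi>2 A *v ((mat 1 - t *\<^sub>R A) *v g k))) =
     (g \<nu>1 \<bullet> (mat_fun \<psi>3 A *v ((mat 1 - t *\<^sub>R A) *v g k))) *
     (g \<nu>2 \<bullet> (mat_fun \<psi>4 A *v ((mat 1 - t *\<^sub>R A) *v g k)))"

text \<open>The equation is meant to determine the stepsize. Without the last conjunct every stepsize
  would qualify: for \<open>\<psi>1 = \<psi>3\<close> and \<open>\<psi>2 = \<psi>4\<close> the equation is an identity in \<open>t\<close>. So it is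
  required not to hold for all stepsizes. The exception is \<open>g k\<close> being zero or an
  eigenvector: there the equation holds for every \<open>t\<close> whatever the \<open>\<psi>\<close>s are, and the stepsize
  is admitted as it stands.\<close>

definition two_dim_termination ::
  "real^'n^'n \<Rightarrow> (nat \<Rightarrow> real^'n) \<Rightarrow> nat \<Rightarrow> real \<Rightarrow> bool" where
  "two_dim_termination A g k \<alpha> \<longleftrightarrow>
     (\<exists>\<nu>1\<in>{1..k}. \<exists>\<nu>2\<in>{1..k}. \<exists>\<psi>1 \<psi>2 \<psi>3 \<psi>4.
        admissible A \<psi>1 \<and> admissible A \<psi>2 \<and> admissible A \<psi>3 \<and> admissible A \<psi>4 \<and>
        (\<forall>z. \<psi>1 z * \<psi>2 z = \<psi>3 z * \<psi>4 z) \<and>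
        termination_eq A g k \<nu>1 \<nu>2 \<psi>1 \<psi>2 \<psi>3 \<psi>4 \<alpha> \<and>
        (\<not> (\<forall>t>0. termination_eq A g k \<nu>1 \<nu>2 \<psi>1 \<psi>2 \<psi>3 \<psi>4 t) \<or> (\<exists>\<mu>. A *v g k = \<mu> *\<^sub>R g k)))"

end

theory Submission
  imports Defs
begin

text \<open>The orthonormality of \<open>u, v, r\<close> makes \<open>H_mat A u v r\<close> orthogonally similar to \<open>A\<close>, so the cubic
  is the characteristic polynomial of \<open>A\<close> and the new stepsize is \<open>1 / \<lambda>\<^sub>3\<close>, which annihilates the
  third gradient component for good. From then on, since \<open>\<psi>1 \<psi>2 = \<psi>3 \<psi>4\<close>, the diagonal terms of the
  termination equation cancel and what is left is a \<open>t\<close>-independent constant times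
  \<open>(1 - t \<lambda>\<^sub>1) (1 - t \<lambda>\<^sub>2)\<close>. The next gradient is therefore an eigenvector (or zero), and on
  eigenvectors with eigenvalue \<open>\<mu>\<close> the generalized stepsize formula evaluates to \<open>1 / \<mu>\<close>.\<close>

lemma orthonormal_family_inner_expand:
  fixes q :: "'n::finite \<Rightarrow> real^'n"
  assumes "orthonormal_family q"
  shows "x \<bullet> y = (\<Sum>i\<in>UNIV. (q i \<bullet> x) * (q i \<bullet> y))"
proof -
  have "x \<bullet> y = x \<bullet> (\<Sum>i\<in>UNIV. (q i \<bullet> y) *\<^sub>R q i)"
    by (simp add: orthonormal_family_expand[OF assms])
  also have "\<dots> = (\<Sum>i\<in>UNIV. (q i \<bullet> x) * (q i \<bullet> y))"
    unfolding inner_sum_right inner_scaleR_right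
    by (intro sum.cong refl) (metis inner_commute mult.commute)
  finally show ?thesis .
qed

lemma orthonormal_family_eqI:
  fixes q :: "'n::finite \<Rightarrow> real^'n"
  assumes "orthonormal_family q" and "\<And>i. q i \<bullet> x = q i \<bullet> y"
  shows "x = y"
proof -
  have "(\<Sum>i\<in>UNIV. (q i \<bullet> x) *\<^sub>R q i) = (\<Sum>i\<in>UNIV. (q i \<bullet> y) *\<^sub>R q i)"
    by (simp only: assms(2))
  then show ?thesis
    by (simp only: orthonormal_family_expand[OF assms(1)])
qed

lemma orthonormal_family_nonzero:
  assumes "orthonormal_family q"
  shows "q i \<noteq> 0"
  using assms unfolding orthonormal_family_def by (metis inner_zero_left zero_neq_one)

text \<open>Stated for an arbitrary \<open>B\<close> because it serves both \<open>A\<close> itself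
  and the matrix functions \<open>mat_fun \<psi> A\<close>, which share the eigenbasis
  \<open>q\<close>.\<close>

lemma eigenbasis_coord:
  fixes q :: "'n::finite \<Rightarrow> real^'n"
  assumes q: "orthonormal_family q" and eig: "\<And>i. B *v q i = m i *\<^sub>R q i"
  shows "q j \<bullet> (B *v w) = m j * (q j \<bullet> w)"
proof -
  have "B *v w = B *v (\<Sum>i\<in>UNIV. (q i \<bullet> w) *\<^sub>R q i)"
    by (simp add: orthonormal_family_expand[OF q])
  also have "\<dots> = (\<Sum>i\<in>UNIV. (q i \<bullet> w) *\<^sub>R (m i *\<^sub>R q i))"
    by (simp add: linear_sum[OF matrix_vector_mul_linear] matrix_vector_mult_scaleR eig)
  finally have "q j \<bullet> (B *v w) = (\<Sum>i\<in>UNIV. (q i \<bullet> w) * (m i * (q j \<bullet> q i)))"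
    by (simp add: inner_sum_right mult.assoc)
  also have "\<dots> = (\<Sum>i\<in>UNIV. if j = i then (q i \<bullet> w) * m i else 0)"
    using q by (intro sum.cong) (auto simp: orthonormal_family_def)
  finally show ?thesis by simp
qed

text \<open>Supplies the finiteness of the spectrum, without which the \<open>Min\<close> and
  \<open>Max\<close> in \<open>admissible\<close> could not be evaluated.\<close>

lemma spectrum_eigenbasis:
  fixes q :: "'n::finite \<Rightarrow> real^'n"
  assumes q: "orthonormal_family q" and eig: "\<And>i. A *v q i = l i *\<^sub>R q i"
  shows "spectrum A = range l"
proof
  show "range l \<subseteq> spectrum A"
  proof
    fix z assume "z \<in> range l"
    then obtain i where "z = l i" by auto
    moreover have "q i \<noteq> 0"
      by (rule orthonormal_family_nonzero[OF q])
    ultimately show "z \<in> spectrum A"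
      using eig[of i] by (auto simp: spectrum_def)
  qed
  show "spectrum A \<subseteq> range l"
  proof
    fix z assume "z \<in> spectrum A"
    then obtain w where w: "w \<noteq> 0" "A *v w = z *\<^sub>R w"
      by (auto simp: spectrum_def)
    obtain i where i: "q i \<bullet> w \<noteq> 0"
      using orthonormal_family_eqI[OF q, of w 0] w(1) by auto
    have "l i * (q i \<bullet> w) = z * (q i \<bullet> w)"
      using eigenbasis_coord[OF q eig] w(2) by (metis inner_scaleR_right)
    with i have "z = l i" by simp
    then show "z \<in> range l" by simp
  qed
qed

text \<open>In a finite spectrum every eigenvalue lies between \<open>Min\<close> and
  \<open>Max\<close>, hence in the interval on which admissibility gives positivity.\<close>

lemma admissible_pos:
  fixes A :: "real^'n^'n"
  assumes "admissible A \<psi>" "finite (spectrum A)" "z \<in> spectrum A"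
  shows "0 < \<psi> z"
  using assms by (auto simp: admissible_def Let_def)

lemma sym_pos_def_eigenvalue_pos:
  assumes "sym_pos_def A" "w \<noteq> 0" "A *v w = z *\<^sub>R w"
  shows "0 < z"
proof -
  have "0 < z * (w \<bullet> w)"
    using assms by (metis sym_pos_def_def inner_scaleR_right)
  then show ?thesis
    by (metis inner_ge_zero mult_nonpos_nonneg not_less)
qed

lemma alpha_new_eq:
  fixes A :: "real^3^3" and q :: "3 \<Rightarrow> real^3"
  assumes q: "orthonormal_family q" and eig: "\<And>i. A *v q i = l i *\<^sub>R q i"
    and ord: "l 1 \<le> l 2" "l 2 \<le> l 3"
    and on: "norm u = 1" "norm v = 1" "norm r = 1" "u \<bullet> v = 0" "u \<bullet> r = 0" "v \<bullet> r = 0"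
  shows "alpha_new A u v r = 1 / l 3"
proof -
  define H where "H = H_mat A u v r"
  \<comment> \<open>Indexing \<open>u\<close>, \<open>v\<close>, \<open>r\<close> by the type
    \<open>3\<close> gives all entries of \<open>H\<close> the single formula
    \<open>p i \<bullet> (A *v p j)\<close>. Row \<open>i\<close> of \<open>R\<close> holds the
    coordinates of \<open>p i\<close> in the eigenbasis, so \<open>R\<close> is orthogonal.\<close>
  define p :: "3 \<Rightarrow> real^3" where "p = (\<lambda>i. if i = 1 then u else if i = 2 then v else r)"
  define R :: "real^3^3" where "R = (\<chi> i j. q j \<bullet> p i)"
  define D :: "real^3^3" where "D = (\<chi> i j. if i = j then l i else 0)"
  have uu: "u \<bullet> u = 1" "v \<bullet> v = 1" "r \<bullet> r = 1"
    using on by (simp_all add: norm_eq_1)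
  have "R ** transpose R = mat 1"
  proof -
    have "(R ** transpose R) $ i $ j = p i \<bullet> p j" for i j
      by (simp add: matrix_matrix_mult_def R_def transpose_def orthonormal_family_inner_expand[OF q, of "p i"])
    moreover have "p i \<bullet> p j = (if i = j then 1 else 0)" for i j
      using exhaust_3[of i] exhaust_3[of j] uu on by (auto simp: p_def inner_commute)
    ultimately show ?thesis by (simp add: vec_eq_iff mat_def)
  qed
  \<comment> \<open>For square matrices a right inverse is a left inverse; this order is the one
    that cancels inside products of \<open>R ** D ** transpose R\<close>.\<close>
  then have R: "transpose R ** R = mat 1" by (simp add: matrix_left_right_inverse)
  have H: "H = R ** D ** transpose R"
  proof -
    have "H $ i $ j = (R ** D ** transpose R) $ i $ j" for i j
    proof -
      have "H $ i $ j = p i \<bullet> (A *v p j)"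
        using exhaust_3[of i] exhaust_3[of j] by (auto simp: H_def H_mat_def p_def)
      also have "\<dots> = (\<Sum>m\<in>UNIV. (q m \<bullet> p i) * (l m * (q m \<bullet> p j)))"
        by (simp add: orthonormal_family_inner_expand[OF q, of "p i"] eigenbasis_coord[OF q eig])
      also have "\<dots> = (R ** D ** transpose R) $ i $ j"
        by (simp add: matrix_matrix_mult_def R_def D_def transpose_def sum_3)
      finally show ?thesis .
    qed
    then show ?thesis by (simp add: vec_eq_iff)
  qed
  \<comment> \<open>Cyclicity of the trace moves \<open>transpose R\<close> next to
    \<open>R\<close>.\<close>
  have trH: "trace (R ** M ** transpose R) = trace M" for M :: "real^3^3"
    by (metis R matrix_mul_assoc matrix_mul_lid trace_mul_sym)
  have "H ** H = R ** (D ** (transpose R ** R) ** D) ** transpose R"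
    by (simp add: H matrix_mul_assoc)
  then have HH: "H ** H = R ** (D ** D) ** transpose R"
    by (simp add: R)
  have "det H = det (transpose R ** R) * det D"
    by (simp add: H det_mul)
  then have det: "det H = l 1 * l 2 * l 3"
    by (simp add: R) (simp add: det_3 D_def)
  have tr: "trace H = l 1 + l 2 + l 3"
    by (simp add: H trH) (simp add: trace_def D_def sum_3)
  have tr2: "trace (H ** H) = (l 1)\<^sup>2 + (l 2)\<^sup>2 + (l 3)\<^sup>2"
    by (simp add: HH trH) (simp add: trace_def D_def sum_3 matrix_matrix_mult_def power2_eq_square)
  \<comment> \<open>Vieta: half the difference of \<open>(trace H)\<^sup>2\<close> and the sum of
    the squared eigenvalues is their second elementary symmetric polynomial.\<close>
  have "z ^ 3 - trace H * z\<^sup>2 + ((trace H)\<^sup>2 - trace (H ** H)) / 2 * z - det H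
      = (z - l 1) * (z - l 2) * (z - l 3)" for z
    unfolding tr tr2 det by (simp add: field_simps power2_eq_square power3_eq_cube)
  then have "{z. z ^ 3 - trace H * z\<^sup>2 + ((trace H)\<^sup>2 - trace (H ** H)) / 2 * z - det H = 0}
      = {l 1, l 2, l 3}" by auto
  moreover have "Max {l 1, l 2, l 3} = l 3"
    using ord by (intro Max_eqI) auto
  ultimately show ?thesis
    by (simp add: alpha_new_def Let_def flip: H_def)
qed

lemma gradient_run_grad_Suc:
  assumes "gradient_run step A b x" "n \<ge> 1"
  shows "grad A b (x (Suc n)) =
    grad A b (x n) - step A b (x 1) n *\<^sub>R (A *v grad A b (x n))"
  using assms
  by (simp add: gradient_run_def grad_def matrix_vector_mult_diff_distrib matrix_vector_mult_scaleR)

text \<open>The terms with the square of \<open>e1\<close> or \<open>e2\<close> carry the factors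
  \<open>a1 * b1 - c1 * d1\<close> and \<open>a2 * b2 - c2 * d2\<close>, which vanish; only mixed
  terms survive, all divisible by \<open>e1 * e2\<close>. In the application \<open>e1\<close>,
  \<open>e2\<close> are the factors \<open>1 - s * l i\<close>, the letters \<open>a\<close> to
  \<open>d\<close> are values of the \<psi>s at \<open>l 1\<close> and \<open>l 2\<close>, and
  \<open>x\<close>, \<open>z\<close>, \<open>m\<close> are gradient coordinates.\<close>

lemma two_term_product_eq_iff:
  fixes a1 :: real
  assumes "a1 * b1 = c1 * d1" "a2 * b2 = c2 * d2"
  shows "(a1 * (x1 * e1 * m1) + a2 * (x2 * e2 * m2)) * (b1 * (z1 * e1 * m1) + b2 * (z2 * e2 * m2)) =
    (c1 * (x1 * e1 * m1) + c2 * (x2 * e2 * m2)) * (d1 * (z1 * e1 * m1) + d2 * (z2 * e2 * m2)) \<longleftrightarrow>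
    ((a1 * b2 - c1 * d2) * x1 * z2 + (a2 * b1 - c2 * d1) * x2 * z1) * m1 * m2 * (e1 * e2) = 0"
  (is "?L = ?R \<longleftrightarrow> ?X = 0")
proof -
  have "?L - ?R = (a1 * b1 - c1 * d1) * (x1 * z1 * (e1 * m1)\<^sup>2) +
      (a2 * b2 - c2 * d2) * (x2 * z2 * (e2 * m2)\<^sup>2) + ?X"
    by (simp only: left_diff_distrib right_diff_distrib distrib_left distrib_right power2_eq_square)
      (simp only: mult_ac)
  also have "\<dots> = ?X"
    unfolding assms diff_self mult_zero_left add_0_left ..
  finally have "?L - ?R = 0 \<longleftrightarrow> ?X = 0"
    by (rule arg_cong)
  then show ?thesis
    unfolding right_minus_eq .
qed

text \<open>With the third coordinate gone, the termination equation lives in a plane and forces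
  \<open>t\<close> to annihilate one of the two remaining coordinates, unless \<open>g n\<close> is
  already an eigenvector or zero. The conclusion deliberately includes the case that the next
  gradient is zero.\<close>

lemma two_dim_termination_eigenvector:
  fixes A :: "real^3^3" and q :: "3 \<Rightarrow> real^3"
  assumes q: "orthonormal_family q" and eig: "\<And>i. A *v q i = l i *\<^sub>R q i"
    and third: "q 3 \<bullet> g n = 0"
    and termin: "two_dim_termination A g n t"
  shows "\<exists>\<mu>. A *v (g n - t *\<^sub>R (A *v g n)) = \<mu> *\<^sub>R (g n - t *\<^sub>R (A *v g n))"
proof -
  obtain \<nu>1 \<nu>2 \<psi>1 \<psi>2 \<psi>3 \<psi>4
    where prod: "\<And>z. \<psi>1 z * \<psi>2 z = \<psi>3 z * \<psi>4 z"
      and eq: "termination_eq A g n \<nu>1 \<nu>2 \<psi>1 \<psi>2 \<psi>3 \<psi>4 t"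
      and alt: "\<not> (\<forall>s>0. termination_eq A g n \<nu>1 \<nu>2 \<psi>1 \<psi>2 \<psi>3 \<psi>4 s) \<or> (\<exists>\<mu>. A *v g n = \<mu> *\<^sub>R g n)"
    using termin unfolding two_dim_termination_def by blast
  note coordA = eigenbasis_coord[OF q eig]
  define y where "y = g n - t *\<^sub>R (A *v g n)"
  have y: "q i \<bullet> y = (1 - t * l i) * (q i \<bullet> g n)" for i
    by (simp add: y_def inner_diff_right coordA algebra_simps)
  show ?thesis
  proof (cases "\<exists>\<mu>. A *v g n = \<mu> *\<^sub>R g n")
    case True
    then obtain \<mu> where "A *v g n = \<mu> *\<^sub>R g n" ..
    then have "A *v (g n - t *\<^sub>R (A *v g n)) = \<mu> *\<^sub>R (g n - t *\<^sub>R (A *v g n))"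
      by (simp add: matrix_vector_mult_diff_distrib matrix_vector_mult_scaleR algebra_simps)
    then show ?thesis ..
  next
    case False
    have form: "g \<nu> \<bullet> (mat_fun \<psi> A *v ((mat 1 - s *\<^sub>R A) *v g n)) =
        \<psi> (l 1) * ((q 1 \<bullet> g \<nu>) * (1 - s * l 1) * (q 1 \<bullet> g n)) +
        \<psi> (l 2) * ((q 2 \<bullet> g \<nu>) * (1 - s * l 2) * (q 2 \<bullet> g n))" for \<psi> \<nu> s
      unfolding orthonormal_family_inner_expand[OF q, of "g \<nu>"]
        eigenbasis_coord[OF q mat_fun_eigenbasis[OF q eig]]
      by (simp add: sum_3 third matrix_vector_mult_diff_rdistrib scaleR_matrix_vector_assoc[symmetric]
          inner_diff_right coordA algebra_simps)
    \<comment> \<open>The coefficient that \<open>two_term_product_eq_iff\<close> leaves in front of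
      the two stepsize factors; it does not depend on \<open>s\<close>.\<close>
    define K where "K = ((\<psi>1 (l 1) * \<psi>2 (l 2) - \<psi>3 (l 1) * \<psi>4 (l 2)) * (q 1 \<bullet> g \<nu>1) * (q 2 \<bullet> g \<nu>2) +
        (\<psi>1 (l 2) * \<psi>2 (l 1) - \<psi>3 (l 2) * \<psi>4 (l 1)) * (q 2 \<bullet> g \<nu>1) * (q 1 \<bullet> g \<nu>2)) *
        (q 1 \<bullet> g n) * (q 2 \<bullet> g n)"
    have teq: "termination_eq A g n \<nu>1 \<nu>2 \<psi>1 \<psi>2 \<psi>3 \<psi>4 s \<longleftrightarrow> K * ((1 - s * l 1) * (1 - s * l 2)) = 0" for s
      unfolding termination_eq_def form K_def by (rule two_term_product_eq_iff) (rule prod)+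
    \<comment> \<open>For \<open>K = 0\<close> the equation would hold for every stepsize, which
      \<open>alt\<close> excludes when \<open>g n\<close> is not an eigenvector.\<close>
    have "K \<noteq> 0" using alt False teq by auto
    then consider "1 - t * l 1 = 0" | "1 - t * l 2 = 0" using eq teq by auto
    \<comment> \<open>At most one coordinate of \<open>y\<close> is left, and its eigenvalue is the
      witness.\<close>
    then have "\<exists>\<mu>. \<forall>i. l i * (q i \<bullet> y) = \<mu> * (q i \<bullet> y)"
    proof cases
      case 1
      then show ?thesis by (intro exI[of _ "l 2"]) (auto simp: forall_3 y third)
    next
      case 2
      then show ?thesis by (intro exI[of _ "l 1"]) (auto simp: forall_3 y third)
    qed
    then obtain \<mu> where "\<And>i. l i * (q i \<bullet> y) = \<mu> * (q i \<bullet> y)" by blast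
    then have "A *v y = \<mu> *\<^sub>R y"
      by (intro orthonormal_family_eqI[OF q]) (simp add: coordA)
    then show ?thesis unfolding y_def ..
  qed
qed

text \<open>Both quadratic forms are multiples of \<open>w \<bullet> w\<close>; after cancelling
  this and \<open>\<psi> \<mu>\<close> the quotient is \<open>\<mu> powr (- c)\<close>, whose power
  \<open>1 / c\<close> is the reciprocal of \<mu>.\<close>

lemma eigenvector_stepsize:
  fixes q :: "'n::finite \<Rightarrow> real^'n" and c :: real
  assumes q: "orthonormal_family q" and eig: "\<And>i. A *v q i = l i *\<^sub>R q i"
    and w: "A *v w = \<mu> *\<^sub>R w" "w \<noteq> 0" and pos: "0 < \<mu>" "0 < \<psi> \<mu>" and c: "c \<noteq> 0"
  shows "((w \<bullet> (mat_fun \<psi> A *v w)) /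
    (w \<bullet> ((mat_fun \<psi> A ** mat_fun (\<lambda>z. z powr c) A) *v w))) powr (1 / c) = 1 / \<mu>"
proof -
  have fw: "mat_fun f A *v w = f \<mu> *\<^sub>R w" for f
    by (rule mat_fun_eigenvector[OF q eig w(1)])
  have "(w \<bullet> (mat_fun \<psi> A *v w)) / (w \<bullet> ((mat_fun \<psi> A ** mat_fun (\<lambda>z. z powr c) A) *v w))
      = \<mu> powr (- c)"
    using w(2) pos by (simp add: fw matrix_vector_mul_assoc[symmetric] matrix_vector_mult_scaleR powr_minus_divide)
  then show ?thesis
    using pos(1) c by (simp only: powr_powr) (simp add: powr_minus_divide)
qed

theorem theorem2p2:
  fixes A :: "real^3^3" and b :: "real^3"
    and q :: "3 \<Rightarrow> real^3" and l :: "3 \<Rightarrow> real"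
    and step :: "3 step_rule" and x g :: "nat \<Rightarrow> real^3" and \<alpha> :: "nat \<Rightarrow> real"
    and k :: nat and u v r :: "real^3"
  assumes spd: "sym_pos_def A"
    and eigenbasis: "orthonormal_family q" "\<And>i. A *v q i = l i *\<^sub>R q i"
    and ordered: "l 1 \<le> l 2" "l 2 \<le> l 3"
    and invariant: "orthogonally_invariant step"
    and run: "gradient_run step A b x"
    and stepsizes: "\<alpha> = step A b (x 1)" "\<And>n. n \<ge> 1 \<Longrightarrow> \<alpha> n > 0"
    and gradients: "g = (\<lambda>n. grad A b (x n))"
    and k: "k \<ge> 1"
    and orthonormal: "norm u = 1" "norm v = 1" "norm r = 1" "u \<bullet> v = 0" "u \<bullet> r = 0" "v \<bullet> r = 0"
    and new_step: "\<alpha> k = alpha_new A u v r"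
  shows "(\<forall>i\<ge>1. q 3 \<bullet> g (k + i) = 0) \<and>
    (\<forall>j0 j i0 (c::real) \<psi>.
       j0 \<ge> 3 \<and> two_dim_termination A g (k + j0) (\<alpha> (k + j0)) \<and>
       j \<ge> j0 + 1 \<and> i0 \<in> {j0 + 1..j} \<and> c \<noteq> 0 \<and> admissible A \<psi> \<and>
       \<alpha> (k + j) =
         ((g (k + i0) \<bullet> (mat_fun \<psi> A *v g (k + i0))) /
          (g (k + i0) \<bullet> ((mat_fun \<psi> A ** mat_fun (\<lambda>z. z powr c) A) *v g (k + i0)))) powr (1 / c)
       \<longrightarrow> (\<exists>i\<in>{1..j + 1}. g (k + i) = 0))"
proof -
  note q = eigenbasis(1) and eig = eigenbasis(2)
  have g_Suc: "g (Suc n) = g n - \<alpha> n *\<^sub>R (A *v g n)" if "n \<ge> 1" for n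
    using gradient_run_grad_Suc[OF run that] by (simp add: gradients stepsizes(1))
  have coord_Suc: "q i \<bullet> g (Suc n) = (1 - \<alpha> n * l i) * (q i \<bullet> g n)" if "n \<ge> 1" for i n
    by (simp add: g_Suc[OF that] inner_diff_right eigenbasis_coord[OF q eig] algebra_simps)
  have spec: "spectrum A = range l" by (rule spectrum_eigenbasis[OF q eig])
  have "l 3 > 0"
    by (rule sym_pos_def_eigenvalue_pos[OF spd orthonormal_family_nonzero[OF q] eig])
  then have \<alpha>k: "1 - \<alpha> k * l 3 = 0"
    using new_step alpha_new_eq[OF q eig ordered orthonormal] by simp
  \<comment> \<open>The step at \<open>k\<close> multiplies the third coordinate by zero, and every
    later step only rescales it.\<close>
  have third: "q 3 \<bullet> g (k + i) = 0" if "i \<ge> 1" for i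
    using that
  proof (induction i rule: dec_induct)
    case base
    then show ?case using coord_Suc[OF k, of 3] \<alpha>k by simp
  next
    case (step i)
    then show ?case using coord_Suc[of "k + i" 3] k by simp
  qed
  have vanish: "\<exists>i\<in>{1..j + 1}. g (k + i) = 0"
    if j0: "j0 \<ge> 3" and td: "two_dim_termination A g (k + j0) (\<alpha> (k + j0))"
      and i0: "i0 \<in> {j0 + 1..j}" and c: "c \<noteq> 0" and adm: "admissible A \<psi>"
      and \<alpha>j: "\<alpha> (k + j) = ((g (k + i0) \<bullet> (mat_fun \<psi> A *v g (k + i0))) /
        (g (k + i0) \<bullet> ((mat_fun \<psi> A ** mat_fun (\<lambda>z. z powr c) A) *v g (k + i0)))) powr (1 / c)"
    for j0 j i0 and c :: real and \<psi>
  proof (cases "g (k + i0) = 0")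
    case True
    then show ?thesis using i0 by (intro bexI[of _ i0]) auto
  next
    case False
    have "q 3 \<bullet> g (k + j0) = 0" using j0 by (intro third) simp
    from two_dim_termination_eigenvector[OF q eig this td]
    obtain \<mu> where "A *v (g (k + j0) - \<alpha> (k + j0) *\<^sub>R (A *v g (k + j0))) =
        \<mu> *\<^sub>R (g (k + j0) - \<alpha> (k + j0) *\<^sub>R (A *v g (k + j0)))" ..
    then have \<mu>: "A *v g (Suc (k + j0)) = \<mu> *\<^sub>R g (Suc (k + j0))"
      using g_Suc[of "k + j0"] k by simp
    have eigen: "A *v g m = \<mu> *\<^sub>R g m" if "m \<ge> Suc (k + j0)" for m
      using that
    proof (induction m rule: dec_induct)
      case base
      show ?case by (rule \<mu>)
    next
      case (step m)
      then show ?case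
        by (simp add: g_Suc matrix_vector_mult_diff_distrib matrix_vector_mult_scaleR algebra_simps)
    qed
    have e0: "A *v g (k + i0) = \<mu> *\<^sub>R g (k + i0)" using i0 by (intro eigen) auto
    have "\<mu> > 0" by (rule sym_pos_def_eigenvalue_pos[OF spd False e0])
    moreover have "\<psi> \<mu> > 0"
    proof (rule admissible_pos[OF adm])
      show "finite (spectrum A)" by (simp add: spec)
      show "\<mu> \<in> spectrum A" unfolding spectrum_def using False e0 by blast
    qed
    ultimately have "\<alpha> (k + j) = 1 / \<mu>"
      unfolding \<alpha>j by (intro eigenvector_stepsize[OF q eig e0 False] c)
    moreover have "A *v g (k + j) = \<mu> *\<^sub>R g (k + j)" using i0 by (intro eigen) auto
    \<comment> \<open>On the eigenspace of \<mu> the step with stepsize \<open>1 / \<mu>\<close>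
      multiplies the gradient by zero, one index after \<open>k + j\<close>.\<close>
    ultimately have "g (k + (j + 1)) = 0"
      using g_Suc[of "k + j"] k \<open>\<mu> > 0\<close> by simp
    then show ?thesis by (intro bexI[of _ "j + 1"]) auto
  qed
  show ?thesis
    by (intro conjI allI impI, erule third, elim conjE, rule vanish)
qed

end
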